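(* Consider the rank-1 inhomogeneous random graph on $n$ vertices with i.i.d. weights having density $\rho(h)=(\tau-1)h^{-\tau}$, $h\ge1$, with $\tau\in(2,3)$, mean weight $\mu=(\tau-1)/(\tau-2)$ and connection probability $p(h,h')=\min\{hh'/(\mu n),1\}$. Put $\gamma_n=\sqrt{n\mu}$. Then the average number $A_k(n)$ of cliques of size $k\ge3$ satisfies $$A_k(n)=O\left[\binom nk\,\gamma_n^{k(1-\tau)}\,e^{2\sqrt{k(\tau-1)/e}}\right],$$ with an implied constant not depending on $k$; that is, there is a constant $C<\infty$ depending only on $\tau$ such that for every integer $k\ge3$ $$\limsup_{n\to\infty}\frac{A_k(n)}{\binom nk\,\gamma_n^{k(1-\tau)}\,e^{2\sqrt{k(\tau-1)/e}}}\le C .$$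
   Context: Model: the graph has $n$ vertices with i.i.d. weights $H_1,\dots,H_n$ with density $\rho$; conditionally on the weights, each pair of vertices $i\ne j$ is connected by an edge independently with probability $p(H_i,H_j)$. The average number of $k$-cliques is $$A_k(n)=\binom nk\int_1^\infty\cdots\int_1^\infty\rho(h_1)\cdots\rho(h_k)\prod_{1\le i<j\le k}\min\Big\{1,\frac{h_ih_j}{\gamma_n^2}\Big\}\,dh_1\cdots dh_k .$$ Here $e$ is the base of the natural logarithm. *)

theory Defs
  imports "HOL-Probability.Probability"
begin

section \<open>Inhomogeneous random graphs with independent weights\<close>

definition vertex_pairs :: "nat set \<Rightarrow> (nat \<times> nat) set" where
  "vertex_pairs S = {(i, j). i \<in> S \<and> j \<in> S \<and> i < j}"

text \<open>
  A graph on the vertices \<open>{..<n}\<close> is represented by its edge indicator \<open>g\<close>; the edge between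
  \<open>i < j\<close> is recorded at \<open>(i, j)\<close> only.  Given the weights \<open>h\<close>, the edge indicators are
  independent, the one at \<open>(i, j)\<close> being Bernoulli with parameter \<open>p (h i) (h j)\<close>, so \<open>p\<close> is meant
  to be symmetric with values in the unit interval.
\<close>

definition edges_given_weights ::
    "(real \<Rightarrow> real \<Rightarrow> real) \<Rightarrow> nat \<Rightarrow> (nat \<Rightarrow> real) \<Rightarrow> (nat \<times> nat \<Rightarrow> bool) pmf" where
  "edges_given_weights p n h =
     Pi_pmf (vertex_pairs {..<n}) False (\<lambda>(i, j). bernoulli_pmf (p (h i) (h j)))"

definition weights_law :: "(real \<Rightarrow> real) \<Rightarrow> nat \<Rightarrow> (nat \<Rightarrow> real) measure" where
  "weights_law \<rho> n = (\<Pi>\<^sub>M i\<in>{..<n}. density lborel (\<lambda>h. ennreal (\<rho> h)))"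

definition random_graph ::
    "(real \<Rightarrow> real) \<Rightarrow> (real \<Rightarrow> real \<Rightarrow> real) \<Rightarrow> nat \<Rightarrow> (nat \<times> nat \<Rightarrow> bool) measure" where
  "random_graph \<rho> p n = weights_law \<rho> n \<bind> (\<lambda>h. measure_pmf (edges_given_weights p n h))"

definition cliques :: "nat \<Rightarrow> nat \<Rightarrow> (nat \<times> nat \<Rightarrow> bool) \<Rightarrow> nat set set" where
  "cliques n k g = {S. S \<subseteq> {..<n} \<and> card S = k \<and> (\<forall>e\<in>vertex_pairs S. g e)}"

definition average_cliques ::
    "(real \<Rightarrow> real) \<Rightarrow> (real \<Rightarrow> real \<Rightarrow> real) \<Rightarrow> nat \<Rightarrow> nat \<Rightarrow> real" where
  "average_cliques \<rho> p n k = (\<integral>g. real (card (cliques n k g)) \<partial>random_graph \<rho> p n)"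


section \<open>The rank-1 model with power-law weights\<close>

definition powerlaw_density :: "real \<Rightarrow> real \<Rightarrow> real" where
  "powerlaw_density \<tau> h = (if 1 \<le> h then (\<tau> - 1) * h powr (- \<tau>) else 0)"

definition mean_weight :: "real \<Rightarrow> real" where
  "mean_weight \<tau> = (\<tau> - 1) / (\<tau> - 2)"

definition rank1_prob :: "real \<Rightarrow> nat \<Rightarrow> real \<Rightarrow> real \<Rightarrow> real" where
  "rank1_prob \<tau> n h h' = min (h * h' / (mean_weight \<tau> * real n)) 1"

definition gam :: "real \<Rightarrow> nat \<Rightarrow> real" where
  "gam \<tau> n = sqrt (real n * mean_weight \<tau>)"

text \<open>The average number \<open>A\<^sub>k(n)\<close> of \<open>k\<close>-cliques in the rank-1 model.\<close>

definition rank1_cliques :: "real \<Rightarrow> nat \<Rightarrow> nat \<Rightarrow> real" where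
  "rank1_cliques \<tau> k n = average_cliques (powerlaw_density \<tau>) (rank1_prob \<tau> n) n k"


section \<open>Consistency of the definitions\<close>

lemma finite_vertex_pairs [simp]: "finite S \<Longrightarrow> finite (vertex_pairs S)"
  by (rule finite_subset[of _ "S \<times> S"]) (auto simp: vertex_pairs_def)

lemma finite_cliques [simp]: "finite (cliques n k g)"
  by (rule finite_subset[of _ "Pow {..<n}"]) (auto simp: cliques_def)

lemma powerlaw_density_nonneg: "1 < \<tau> \<Longrightarrow> 0 \<le> powerlaw_density \<tau> h"
  by (simp add: powerlaw_density_def)

lemma measurable_powerlaw_density [measurable]: "powerlaw_density \<tau> \<in> borel_measurable borel"
  unfolding powerlaw_density_def by measurable

lemma measurable_rank1_prob [measurable]:
  "(\<lambda>x. rank1_prob \<tau> n (fst x) (snd x)) \<in> borel_measurable (borel \<Otimes>\<^sub>M borel)"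
  unfolding rank1_prob_def by measurable

lemma nn_integral_powr_tail:
  assumes "1 < (a::real)"
  shows "(\<integral>\<^sup>+h. ennreal (h powr (- a)) * indicator {1..} h \<partial>lborel) = ennreal (1 / (a - 1))"
proof -
  have "((\<lambda>h. h powr (- a)) has_integral - (1 powr (- a + 1)) / (- a + 1)) {1..}"
    using assms by (intro has_integral_powr_to_inf) auto
  hence 1: "((\<lambda>h. h powr (- a)) has_integral 1 / (a - 1)) {1..}"
    using assms by (simp add: minus_divide_right)
  have "(\<integral>\<^sup>+h. ennreal (indicator {1..} h * h powr (- a)) \<partial>lborel) = ennreal (1 / (a - 1))"
    using nn_integral_has_integral_lebesgue[OF _ 1]
    by (simp add: nn_integral_completion)
  moreover have "(\<integral>\<^sup>+h. ennreal (h powr (- a)) * indicator {1..} h \<partial>lborel) =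
      (\<integral>\<^sup>+h. ennreal (indicator {1..} h * h powr (- a)) \<partial>lborel)"
    by (intro nn_integral_cong) (simp add: indicator_def)
  ultimately show ?thesis by simp
qed

lemma prob_space_powerlaw:
  assumes "1 < \<tau>"
  shows "prob_space (density lborel (\<lambda>h. ennreal (powerlaw_density \<tau> h)))"
proof
  have "(\<integral>\<^sup>+h. ennreal (powerlaw_density \<tau> h) \<partial>lborel) =
        (\<integral>\<^sup>+h. ennreal (\<tau> - 1) * (ennreal (h powr (- \<tau>)) * indicator {1..} h) \<partial>lborel)"
    using assms by (intro nn_integral_cong) (auto simp: powerlaw_density_def ennreal_mult' indicator_def)
  also have "\<dots> = 1"
    using assms by (simp add: nn_integral_cmult nn_integral_powr_tail flip: ennreal_mult')
  finally show "emeasure (density lborel (\<lambda>h. ennreal (powerlaw_density \<tau> h)))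
      (space (density lborel (\<lambda>h. ennreal (powerlaw_density \<tau> h)))) = 1"
    by (simp add: emeasure_density)
qed

lemma mean_weight_eq:
  assumes "2 < \<tau>"
  shows "(\<integral>h. h \<partial>density lborel (\<lambda>h. ennreal (powerlaw_density \<tau> h))) = mean_weight \<tau>"
proof -
  have "(\<integral>\<^sup>+h. ennreal (powerlaw_density \<tau> h * h) \<partial>lborel) =
        (\<integral>\<^sup>+h. ennreal (\<tau> - 1) * (ennreal (h powr (- (\<tau> - 1))) * indicator {1..} h) \<partial>lborel)"
    using assms by (intro nn_integral_cong)
      (auto simp: powerlaw_density_def indicator_def powr_diff powr_minus field_simps simp flip: ennreal_mult')
  also have "\<dots> = ennreal (mean_weight \<tau>)"
    using assms by (subst nn_integral_cmult, simp, subst nn_integral_powr_tail)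
      (auto simp: mean_weight_def simp flip: ennreal_mult')
  finally have "(\<integral>h. powerlaw_density \<tau> h * h \<partial>lborel) = mean_weight \<tau>"
    using assms by (subst integral_eq_nn_integral) (auto simp: powerlaw_density_def mean_weight_def)
  thus ?thesis
    using assms by (subst integral_density) (auto simp: powerlaw_density_nonneg)
qed

lemma pmf_bernoulli_clamp:
  "pmf (bernoulli_pmf q) b = (if b then min 1 (max 0 q) else 1 - min 1 (max 0 q))"
  by (simp add: bernoulli_pmf.rep_eq)

lemma measurable_weight_prob:
  assumes p: "(\<lambda>x. p (fst x) (snd x)) \<in> borel_measurable (borel \<Otimes>\<^sub>M borel)"
    and "i < n" "j < n"
  shows "(\<lambda>h. p (h i) (h j)) \<in> borel_measurable (weights_law \<rho> n)"
proof -
  have "(\<lambda>h. (h i, h j)) \<in> weights_law \<rho> n \<rightarrow>\<^sub>M borel \<Otimes>\<^sub>M borel"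
    using assms unfolding weights_law_def
    by (intro measurable_Pair measurable_compose[OF measurable_component_singleton, of _ _ _ "\<lambda>x. x"]) auto
  from measurable_compose[OF this p] show ?thesis by simp
qed

lemma measurable_edges_given_weights:
  assumes p [measurable]: "(\<lambda>x. p (fst x) (snd x)) \<in> borel_measurable (borel \<Otimes>\<^sub>M borel)"
  shows "(\<lambda>h. measure_pmf (edges_given_weights p n h))
           \<in> measurable (weights_law \<rho> n) (subprob_algebra (count_space UNIV))"
proof (rule measurable_subprob_algebra)
  fix h assume "h \<in> space (weights_law \<rho> n)"
  show "subprob_space (measure_pmf (edges_given_weights p n h))"
    by (rule measure_pmf.subprob_space_axioms)
next
  fix X :: "(nat \<times> nat \<Rightarrow> bool) set"
  define V where "V = vertex_pairs {..<n}"
  define F where "F = PiE_dflt V False (\<lambda>_. UNIV :: bool set)"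
  have finV: "finite V" by (simp add: V_def)
  have finF: "finite F" unfolding F_def by (intro finite_PiE_dflt finV) auto
  have eq: "emeasure (measure_pmf (edges_given_weights p n h)) X =
      (\<Sum>g\<in>X \<inter> F. ennreal (\<Prod>e\<in>V. pmf (bernoulli_pmf (p (h (fst e)) (h (snd e)))) (g e)))" for h
  proof -
    have "emeasure (measure_pmf (edges_given_weights p n h)) X =
          emeasure (measure_pmf (edges_given_weights p n h)) (X \<inter> F)"
      by (intro emeasure_eq_AE AE_pmfI)
         (use finV in \<open>auto simp: edges_given_weights_def F_def set_Pi_pmf PiE_dflt_def simp flip: V_def\<close>)
    also have "\<dots> = (\<Sum>g\<in>X \<inter> F. ennreal (pmf (edges_given_weights p n h) g))"
      using finF by (subst emeasure_measure_pmf_finite) auto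
    also have "\<dots> = (\<Sum>g\<in>X \<inter> F. ennreal (\<Prod>e\<in>V. pmf (bernoulli_pmf (p (h (fst e)) (h (snd e)))) (g e)))"
      using finV by (intro sum.cong refl arg_cong[where f = ennreal])
        (auto simp: edges_given_weights_def pmf_Pi F_def PiE_dflt_def case_prod_unfold simp flip: V_def)
    finally show ?thesis .
  qed
  have [measurable]: "(\<lambda>h. p (h (fst e)) (h (snd e))) \<in> borel_measurable (weights_law \<rho> n)" if "e \<in> V" for e
    using that by (intro measurable_weight_prob p) (auto simp: V_def vertex_pairs_def)
  show "(\<lambda>h. emeasure (measure_pmf (edges_given_weights p n h)) X) \<in> borel_measurable (weights_law \<rho> n)"
    unfolding eq pmf_bernoulli_clamp by measurable
qed auto

lemma prob_space_weights_law:
  assumes "prob_space (density lborel (\<lambda>h. ennreal (\<rho> h)))"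
  shows "prob_space (weights_law \<rho> n)"
  unfolding weights_law_def by (intro prob_space_PiM assms)

lemma prob_space_random_graph:
  assumes "prob_space (density lborel (\<lambda>h. ennreal (\<rho> h)))"
    and "(\<lambda>x. p (fst x) (snd x)) \<in> borel_measurable (borel \<Otimes>\<^sub>M borel)"
  shows "prob_space (random_graph \<rho> p n)"
  unfolding random_graph_def
  by (rule prob_space.prob_space_bind[OF prob_space_weights_law[OF assms(1)] _
        measurable_edges_given_weights[OF assms(2)]]) (simp add: measure_pmf.prob_space_axioms)

lemma prob_clique_given_weights:
  assumes "S \<subseteq> {..<n}"
  shows "measure_pmf.prob (edges_given_weights p n h) {g. \<forall>e\<in>vertex_pairs S. g e} =
         (\<Prod>(i, j)\<in>vertex_pairs S. pmf (bernoulli_pmf (p (h i) (h j))) True)"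
proof -
  have sub: "vertex_pairs S \<subseteq> vertex_pairs {..<n}"
    using assms by (auto simp: vertex_pairs_def)
  have "{g. \<forall>e\<in>vertex_pairs S. g e} =
        Pi (vertex_pairs {..<n}) (\<lambda>e. if e \<in> vertex_pairs S then {True} else UNIV)"
    using sub by (auto simp: Pi_def split: if_splits)
  hence "measure_pmf.prob (edges_given_weights p n h) {g. \<forall>e\<in>vertex_pairs S. g e} =
     (\<Prod>e\<in>vertex_pairs {..<n}. measure_pmf.prob (case e of (i, j) \<Rightarrow> bernoulli_pmf (p (h i) (h j)))
          (if e \<in> vertex_pairs S then {True} else UNIV))"
    by (simp add: edges_given_weights_def measure_Pi_pmf_Pi)
  also have "\<dots> = (\<Prod>e\<in>vertex_pairs S. measure_pmf.prob (case e of (i, j) \<Rightarrow> bernoulli_pmf (p (h i) (h j)))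
          {True})"
    using sub by (intro prod.mono_neutral_cong_right) auto
  finally show ?thesis
    by (simp add: case_prod_unfold measure_pmf_single)
qed

lemma card_cliques_eq:
  "real (card (cliques n k g)) =
     (\<Sum>S | S \<subseteq> {..<n} \<and> card S = k. indicator {g. \<forall>e\<in>vertex_pairs S. g e} g)"
proof -
  have fin: "finite {S. S \<subseteq> {..<n} \<and> card S = k}"
    by (rule finite_subset[of _ "Pow {..<n}"]) auto
  have "cliques n k g = {S. S \<subseteq> {..<n} \<and> card S = k} \<inter> {S. g \<in> {g. \<forall>e\<in>vertex_pairs S. g e}}"
    by (auto simp: cliques_def)
  thus ?thesis
    using fin by (simp add: indicator_def sum.If_cases Int_def conj_ac)
qed

lemma density_PiM_lborel:
  assumes \<rho> [measurable]: "\<rho> \<in> borel_measurable borel"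
    and prob: "prob_space (density lborel (\<lambda>h. ennreal (\<rho> h)))"
    and nonneg: "\<And>h. 0 \<le> \<rho> h"
  shows "weights_law \<rho> k = density (\<Pi>\<^sub>M i\<in>{..<k}. lborel) (\<lambda>h. ennreal (\<Prod>i<k. \<rho> (h i)))"
proof -
  interpret P: product_prob_space "\<lambda>_. density lborel (\<lambda>h. ennreal (\<rho> h))" "{..<k}"
    by (intro product_prob_spaceI prob)
  interpret L: product_sigma_finite "\<lambda>_::nat. lborel :: real measure"
    by unfold_locales
  show ?thesis
    unfolding weights_law_def
  proof (rule P.PiM_eqI[symmetric])
    fix B :: "nat \<Rightarrow> real set"
    assume "\<And>i. i \<in> {..<k} \<Longrightarrow> B i \<in> sets (density lborel (\<lambda>h. ennreal (\<rho> h)))"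
    hence B [measurable]: "B i \<in> sets borel" if "i < k" for i using that by auto
    have [measurable]: "Pi\<^sub>E {..<k} B \<in> sets (\<Pi>\<^sub>M i\<in>{..<k}. lborel)"
      by (intro sets_PiM_I_finite) auto
    have "emeasure (density (\<Pi>\<^sub>M i\<in>{..<k}. lborel) (\<lambda>h. ennreal (\<Prod>i<k. \<rho> (h i)))) (Pi\<^sub>E {..<k} B) =
       (\<integral>\<^sup>+h. ennreal (\<Prod>i<k. \<rho> (h i)) * indicator (Pi\<^sub>E {..<k} B) h \<partial>(\<Pi>\<^sub>M i\<in>{..<k}. lborel))"
      by (subst emeasure_density) auto
    also have "\<dots> = (\<integral>\<^sup>+h. (\<Prod>i<k. ennreal (\<rho> (h i)) * indicator (B i) (h i)) \<partial>(\<Pi>\<^sub>M i\<in>{..<k}. lborel))"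
    proof (intro nn_integral_cong)
      fix h assume "h \<in> space (\<Pi>\<^sub>M i\<in>{..<k}. lborel :: real measure)"
      hence "(indicator (Pi\<^sub>E {..<k} B) h :: ennreal) = (\<Prod>i<k. indicator (B i) (h i))"
        by (auto simp: space_PiM indicator_def PiE_iff prod_zero_iff prod.If_cases)
      thus "ennreal (\<Prod>i<k. \<rho> (h i)) * indicator (Pi\<^sub>E {..<k} B) h =
            (\<Prod>i<k. ennreal (\<rho> (h i)) * indicator (B i) (h i))"
        by (simp add: prod.distrib nonneg flip: prod_ennreal)
    qed
    also have "\<dots> = (\<Prod>i<k. \<integral>\<^sup>+x. ennreal (\<rho> x) * indicator (B i) x \<partial>lborel)"
      by (rule L.product_nn_integral_prod) auto
    also have "\<dots> = (\<Prod>i<k. emeasure (density lborel (\<lambda>h. ennreal (\<rho> h))) (B i))"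
      by (intro prod.cong refl) (simp add: emeasure_density)
    finally show "emeasure (density (\<Pi>\<^sub>M i\<in>{..<k}. lborel) (\<lambda>h. ennreal (\<Prod>i<k. \<rho> (h i)))) (Pi\<^sub>E {..<k} B) =
        (\<Prod>i\<in>{..<k}. emeasure (density lborel (\<lambda>h. ennreal (\<rho> h))) (B i))" .
  qed (auto intro!: sets_PiM_cong)
qed

lemma integral_clique_prob_eq:
  assumes prob: "prob_space (density lborel (\<lambda>h. ennreal (\<rho> h)))"
    and q: "(\<lambda>x. q (fst x) (snd x)) \<in> borel_measurable (borel \<Otimes>\<^sub>M borel)"
    and S: "S \<subseteq> {..<n}" "card S = k"
  shows "(\<integral>h. (\<Prod>(i, j)\<in>vertex_pairs S. q (h i) (h j)) \<partial>weights_law \<rho> n) =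
         (\<integral>h. (\<Prod>(i, j)\<in>vertex_pairs {..<k}. q (h i) (h j) :: real) \<partial>weights_law \<rho> k)"
proof -
  have finS: "finite S" using S(1) finite_subset by blast
  define f where "f = (\<lambda>i. sorted_list_of_set S ! i)"
  have len: "length (sorted_list_of_set S) = k" using S(2) by simp
  have mono: "f i < f j \<longleftrightarrow> i < j" if "i < k" "j < k" for i j
  proof -
    have sl: "sorted_wrt (<) (sorted_list_of_set S)" by simp
    have "f i < f j" if "i < j" "j < k" for i j
      using sorted_wrt_nth_less[OF sl that(1)] that len by (simp add: f_def)
    from this[of i j] this[of j i] show ?thesis
      using that by (cases i j rule: linorder_cases) auto
  qed
  have bij: "bij_betw f {..<k} S"
    unfolding f_def using finS len
    by (intro bij_betw_nth) auto
  have inj: "inj_on f {..<k}" and img: "f ` {..<k} = S"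
    using bij by (auto simp: bij_betw_def)
  have pairs: "bij_betw (\<lambda>(i, j). (f i, f j)) (vertex_pairs {..<k}) (vertex_pairs S)"
  proof (rule bij_betw_imageI)
    show "inj_on (\<lambda>(i, j). (f i, f j)) (vertex_pairs {..<k})"
      using inj by (auto simp: inj_on_def vertex_pairs_def)
    show "(\<lambda>(i, j). (f i, f j)) ` vertex_pairs {..<k} = vertex_pairs S"
    proof (intro equalityI subsetI)
      fix e assume "e \<in> vertex_pairs S"
      then obtain a b where e: "e = (a, b)" "a \<in> S" "b \<in> S" "a < b"
        by (auto simp: vertex_pairs_def)
      then obtain i j where "a = f i" "b = f j" "i < k" "j < k"
        using img by (metis imageE lessThan_iff)
      thus "e \<in> (\<lambda>(i, j). (f i, f j)) ` vertex_pairs {..<k}"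
        using e mono[of i j] by (intro image_eqI[of _ _ "(i, j)"]) (auto simp: vertex_pairs_def)
    qed (use mono img in \<open>auto simp: vertex_pairs_def\<close>)
  qed
  define T where "T = (\<lambda>h::nat \<Rightarrow> real. \<lambda>i\<in>{..<k}. h (f i))"
  have W: "weights_law \<rho> k = distr (weights_law \<rho> n) (weights_law \<rho> k) T"
    unfolding weights_law_def T_def using inj img S(1)
    by (intro distr_PiM_reindex[symmetric] prob) auto
  have T: "T \<in> weights_law \<rho> n \<rightarrow>\<^sub>M weights_law \<rho> k"
    unfolding weights_law_def T_def using img S(1)
    by (intro measurable_restrict measurable_component_singleton) auto
  have meas: "(\<lambda>h. \<Prod>(i, j)\<in>vertex_pairs {..<k}. q (h i) (h j)) \<in> borel_measurable (weights_law \<rho> k)"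
    unfolding case_prod_unfold
    by (intro borel_measurable_prod measurable_weight_prob q) (auto simp: vertex_pairs_def)
  have "(\<integral>h. (\<Prod>(i, j)\<in>vertex_pairs {..<k}. q (h i) (h j)) \<partial>weights_law \<rho> k) =
        (\<integral>h. (\<Prod>(i, j)\<in>vertex_pairs {..<k}. q (T h i) (T h j)) \<partial>weights_law \<rho> n)"
    by (subst W, subst integral_distr[OF T meas]) simp
  also have "\<dots> = (\<integral>h. (\<Prod>(i, j)\<in>vertex_pairs S. q (h i) (h j)) \<partial>weights_law \<rho> n)"
  proof (intro Bochner_Integration.integral_cong refl)
    fix h
    have "(\<Prod>(i, j)\<in>vertex_pairs S. q (h i) (h j)) =
          (\<Prod>e\<in>vertex_pairs {..<k}. case (case e of (i, j) \<Rightarrow> (f i, f j)) of (i, j) \<Rightarrow> q (h i) (h j))"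
      by (rule prod.reindex_bij_betw[OF pairs, symmetric])
    also have "\<dots> = (\<Prod>(i, j)\<in>vertex_pairs {..<k}. q (T h i) (T h j))"
      by (intro prod.cong refl) (auto simp: T_def vertex_pairs_def)
    finally show "(\<Prod>(i, j)\<in>vertex_pairs {..<k}. q (T h i) (T h j)) =
        (\<Prod>(i, j)\<in>vertex_pairs S. q (h i) (h j))" ..
  qed
  finally show ?thesis ..
qed

text \<open>
  The expected number of \<open>k\<close>-cliques as an explicit \<open>k\<close>-fold integral over the weights.
\<close>

lemma average_cliques_eq:
  assumes \<rho> [measurable]: "\<rho> \<in> borel_measurable borel"
    and prob: "prob_space (density lborel (\<lambda>h. ennreal (\<rho> h)))"
    and nonneg: "\<And>h. 0 \<le> \<rho> h"
    and p [measurable]: "(\<lambda>x. p (fst x) (snd x)) \<in> borel_measurable (borel \<Otimes>\<^sub>M borel)"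
    and p01: "\<And>h h'. \<rho> h > 0 \<Longrightarrow> \<rho> h' > 0 \<Longrightarrow> 0 \<le> p h h' \<and> p h h' \<le> 1"
  shows "average_cliques \<rho> p n k = real (n choose k) *
           (\<integral>h. (\<Prod>i<k. \<rho> (h i)) * (\<Prod>(i, j)\<in>vertex_pairs {..<k}. p (h i) (h j))
              \<partial>(\<Pi>\<^sub>M i\<in>{..<k}. lborel))"
proof -
  define q where "q = (\<lambda>x y. pmf (bernoulli_pmf (p x y)) True)"
  define Ss where "Ss = {S. S \<subseteq> {..<n} \<and> card S = k}"
  have finSs: "finite Ss"
    unfolding Ss_def by (rule finite_subset[of _ "Pow {..<n}"]) auto
  have q: "(\<lambda>x. q (fst x) (snd x)) \<in> borel_measurable (borel \<Otimes>\<^sub>M borel)"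
    unfolding q_def pmf_bernoulli_clamp by measurable
  interpret W: prob_space "weights_law \<rho> n" by (rule prob_space_weights_law[OF prob])
  have inner: "(\<integral>g. real (card (cliques n k g)) \<partial>measure_pmf (edges_given_weights p n h)) =
        (\<Sum>S\<in>Ss. \<Prod>(i, j)\<in>vertex_pairs S. q (h i) (h j))" for h
  proof -
    have "(\<integral>g. real (card (cliques n k g)) \<partial>measure_pmf (edges_given_weights p n h)) =
      (\<Sum>S\<in>Ss. \<integral>g. indicator {g. \<forall>e\<in>vertex_pairs S. g e} g \<partial>measure_pmf (edges_given_weights p n h))"
      unfolding card_cliques_eq Ss_def
      by (intro Bochner_Integration.integral_sum) (simp add: measure_pmf.emeasure_eq_measure)
    also have "\<dots> = (\<Sum>S\<in>Ss. measure_pmf.prob (edges_given_weights p n h) {g. \<forall>e\<in>vertex_pairs S. g e})"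
      by simp
    also have "\<dots> = (\<Sum>S\<in>Ss. \<Prod>(i, j)\<in>vertex_pairs S. q (h i) (h j))"
      by (intro sum.cong refl) (subst prob_clique_given_weights, auto simp: Ss_def q_def)
    finally show ?thesis .
  qed
  have int: "integrable (weights_law \<rho> n) (\<lambda>h. \<Prod>(i, j)\<in>vertex_pairs S. q (h i) (h j))"
    if "S \<in> Ss" for S
  proof (rule W.integrable_const_bound[of _ 1])
    show "AE h in weights_law \<rho> n. norm (\<Prod>(i, j)\<in>vertex_pairs S. q (h i) (h j)) \<le> 1"
      by (intro AE_I2) (auto simp: q_def case_prod_unfold abs_prod pmf_le_1 intro!: prod_le_1)
    show "(\<lambda>h. \<Prod>(i, j)\<in>vertex_pairs S. q (h i) (h j)) \<in> borel_measurable (weights_law \<rho> n)"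
      unfolding case_prod_unfold using that
      by (intro borel_measurable_prod measurable_weight_prob q) (auto simp: vertex_pairs_def Ss_def)
  qed
  have "average_cliques \<rho> p n k =
      (\<integral>h. (\<integral>g. real (card (cliques n k g)) \<partial>measure_pmf (edges_given_weights p n h)) \<partial>weights_law \<rho> n)"
    unfolding average_cliques_def random_graph_def
  proof (rule integral_bind[where B' = 1 and B = "real (card (Pow {..<n}))"])
    show "(\<lambda>h. measure_pmf (edges_given_weights p n h))
             \<in> measurable (weights_law \<rho> n) (subprob_algebra (count_space UNIV))"
      by (rule measurable_edges_given_weights[OF p])
    have "card (cliques n k g) \<le> card (Pow {..<n})" for g
      by (intro card_mono) (auto simp: cliques_def)
    thus "\<bar>real (card (cliques n k g))\<bar> \<le> real (card (Pow {..<n}))" for g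
      by (simp only: abs_of_nat of_nat_le_iff)
  qed (auto simp: W.finite_measure_axioms)
  also have "\<dots> = (\<Sum>S\<in>Ss. \<integral>h. (\<Prod>(i, j)\<in>vertex_pairs S. q (h i) (h j)) \<partial>weights_law \<rho> n)"
    unfolding inner by (intro Bochner_Integration.integral_sum int)
  also have "\<dots> = (\<Sum>S\<in>Ss. \<integral>h. (\<Prod>(i, j)\<in>vertex_pairs {..<k}. q (h i) (h j)) \<partial>weights_law \<rho> k)"
    by (intro sum.cong refl integral_clique_prob_eq prob q) (auto simp: Ss_def)
  also have "\<dots> = real (n choose k) *
      (\<integral>h. (\<Prod>(i, j)\<in>vertex_pairs {..<k}. q (h i) (h j)) \<partial>weights_law \<rho> k)"
    using n_subsets[of "{..<n}" k] by (simp add: Ss_def)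
  also have "(\<integral>h. (\<Prod>(i, j)\<in>vertex_pairs {..<k}. q (h i) (h j)) \<partial>weights_law \<rho> k) =
      (\<integral>h. (\<Prod>i<k. \<rho> (h i)) * (\<Prod>(i, j)\<in>vertex_pairs {..<k}. q (h i) (h j)) \<partial>(\<Pi>\<^sub>M i\<in>{..<k}. lborel))"
    unfolding density_PiM_lborel[OF \<rho> prob nonneg]
  proof (subst integral_density)
    have "weights_law \<rho> k \<rightarrow>\<^sub>M borel = (\<Pi>\<^sub>M i\<in>{..<k}. lborel) \<rightarrow>\<^sub>M (borel :: real measure)"
      by (intro measurable_cong_sets) (auto simp: weights_law_def intro!: sets_PiM_cong)
    moreover have "(\<lambda>h. \<Prod>(i, j)\<in>vertex_pairs {..<k}. q (h i) (h j)) \<in> borel_measurable (weights_law \<rho> k)"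
      unfolding case_prod_unfold
      by (intro borel_measurable_prod measurable_weight_prob q) (auto simp: vertex_pairs_def)
    ultimately show "(\<lambda>h. \<Prod>(i, j)\<in>vertex_pairs {..<k}. q (h i) (h j))
        \<in> borel_measurable (\<Pi>\<^sub>M i\<in>{..<k}. lborel)"
      by simp
  qed (auto intro!: AE_I2 prod_nonneg nonneg)
  also have "\<dots> = (\<integral>h. (\<Prod>i<k. \<rho> (h i)) * (\<Prod>(i, j)\<in>vertex_pairs {..<k}. p (h i) (h j)) \<partial>(\<Pi>\<^sub>M i\<in>{..<k}. lborel))"
  proof (intro Bochner_Integration.integral_cong refl)
    fix h :: "nat \<Rightarrow> real"
    show "(\<Prod>i<k. \<rho> (h i)) * (\<Prod>(i, j)\<in>vertex_pairs {..<k}. q (h i) (h j)) =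
          (\<Prod>i<k. \<rho> (h i)) * (\<Prod>(i, j)\<in>vertex_pairs {..<k}. p (h i) (h j))"
    proof (cases "\<forall>i<k. \<rho> (h i) > 0")
      case True
      have "(\<Prod>(i, j)\<in>vertex_pairs {..<k}. q (h i) (h j)) = (\<Prod>(i, j)\<in>vertex_pairs {..<k}. p (h i) (h j))"
        using True p01 by (intro prod.cong refl) (auto simp: vertex_pairs_def q_def)
      thus ?thesis by simp
    next
      case False
      hence "\<exists>i<k. \<rho> (h i) = 0" using nonneg by (metis less_eq_real_def)
      hence "(\<Prod>i<k. \<rho> (h i)) = 0" by auto
      thus ?thesis by (simp only: mult_zero_left)
    qed
  qed
  finally show ?thesis .
qed

lemma rank1_cliques_eq:
  assumes "2 < \<tau>"
  shows "rank1_cliques \<tau> k n = real (n choose k) *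
           (\<integral>h. (\<Prod>i<k. powerlaw_density \<tau> (h i)) *
                (\<Prod>(i, j)\<in>vertex_pairs {..<k}. min 1 (h i * h j / (gam \<tau> n)\<^sup>2))
              \<partial>(\<Pi>\<^sub>M i\<in>{..<k}. lborel))"
proof -
  have mu: "0 < mean_weight \<tau>" using assms by (simp add: mean_weight_def)
  hence "rank1_prob \<tau> n h h' = min 1 (h * h' / (gam \<tau> n)\<^sup>2)" for h h'
    by (simp add: rank1_prob_def gam_def mult.commute min.commute)
  moreover have "0 \<le> rank1_prob \<tau> n h h' \<and> rank1_prob \<tau> n h h' \<le> 1"
    if "powerlaw_density \<tau> h > 0" "powerlaw_density \<tau> h' > 0" for h h'
    using that mu by (auto simp: powerlaw_density_def rank1_prob_def split: if_splits)
  ultimately show ?thesis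
    unfolding rank1_cliques_def using assms
    by (subst average_cliques_eq)
       (auto intro: prob_space_powerlaw powerlaw_density_nonneg measurable_rank1_prob)
qed

end

theory Submission
  imports Defs
begin

text \<open>
  Rescale the weights to \<open>x\<^sub>i = h\<^sub>i / \<gamma>\<^sub>n\<close> and split the \<open>k\<close>-fold integral according to the set \<open>A\<close> of
  indices with \<open>x\<^sub>i < 1\<close>.  With \<open>a = card A\<close>, keeping only the pairs inside \<open>A\<close> and bounding the
  remaining factors by 1 leaves \<open>\<Prod>i\<in>A. x\<^sub>i ^ (a - 1)\<close>, whose integral against the power law
  is \<open>((\<tau> - 1) / (a - \<tau>)) ^ a\<close> for \<open>a \<ge> 3\<close>.  For \<open>a = 1\<close> and \<open>a = 2\<close> this diverges at 0, and one
  borrows a (fractional) factor from pairs between \<open>A\<close> and \<open>3 - a\<close> further indices.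
  Since \<open>k choose a \<le> k ^ a / a!\<close>, a Stirling-type bound for \<open>(2 * a)!\<close> dominates the sum over \<open>A\<close> by a
  constant times \<open>\<Sum>a. (2 * z) ^ (2 * a) / (2 * a)! \<le> exp (2 * z)\<close> with \<open>z = sqrt (k * (\<tau> - 1) / e)\<close>.
\<close>

section \<open>Integrals of powers against the power law, below and above a threshold\<close>

lemma nn_integral_powr_from_0:
  fixes a g :: real
  assumes "a > -1" "g \<ge> 0"
  shows "(\<integral>\<^sup>+h. ennreal (indicator {0..g} h * h powr a) \<partial>lborel) = ennreal (g powr (a + 1) / (a + 1))"
  using nn_integral_has_integral_lebesgue[OF _ has_integral_powr_from_0[OF assms]]
  by (simp add: nn_integral_completion)

lemma nn_integral_powr_to_inf:
  fixes a g :: real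
  assumes "a < -1" "g > 0"
  shows "(\<integral>\<^sup>+h. ennreal (indicator {g..} h * h powr a) \<partial>lborel) = ennreal (g powr (a + 1) / (- a - 1))"
proof -
  have "- (g powr (a + 1)) / (a + 1) = g powr (a + 1) / (- a - 1)"
    using assms by (simp add: field_simps)
  with nn_integral_has_integral_lebesgue[OF _ has_integral_powr_to_inf[OF assms]]
  show ?thesis by (simp add: nn_integral_completion)
qed

lemma scaled_powerlaw_eq:
  fixes g h :: real
  assumes "g > 0" "h \<ge> 1"
  shows "powerlaw_density \<tau> h * (h / g) powr e = (\<tau> - 1) * g powr (- e) * h powr (e - \<tau>)"
  using assms by (simp add: powerlaw_density_def powr_divide powr_diff powr_minus field_simps)

text \<open>Substituting h = g x brings out the factor \<open>g powr (1 - \<tau>)\<close>. Dropping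
  the cutoff \<open>1 \<le> h\<close> leaves a power of x on the unit interval, integrable at 0
  because \<open>e\<close> exceeds \<open>\<tau> - 1\<close>.\<close>

lemma nn_integral_powerlaw_below:
  fixes g :: real
  assumes "1 < \<tau>" "\<tau> - 1 < e" "0 < g"
  shows "(\<integral>\<^sup>+h. ennreal (powerlaw_density \<tau> h * (h / g) powr e * indicator {..<g} h) \<partial>lborel)
           \<le> ennreal (g powr (1 - \<tau>) * ((\<tau> - 1) / (e + 1 - \<tau>)))"
proof -
  define K where "K = (\<tau> - 1) * g powr (- e)"
  have K: "K \<ge> 0" using assms by (simp add: K_def)
  have "(\<integral>\<^sup>+h. ennreal (powerlaw_density \<tau> h * (h / g) powr e * indicator {..<g} h) \<partial>lborel)
      \<le> (\<integral>\<^sup>+h. ennreal K * ennreal (indicator {0..g} h * h powr (e - \<tau>)) \<partial>lborel)"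
  proof (rule nn_integral_mono)
    fix h :: real
    show "ennreal (powerlaw_density \<tau> h * (h / g) powr e * indicator {..<g} h)
        \<le> ennreal K * ennreal (indicator {0..g} h * h powr (e - \<tau>))"
    proof (cases "1 \<le> h")
      case True
      then show ?thesis
        using K scaled_powerlaw_eq[OF assms(3) True, of \<tau> e]
        by (auto simp: K_def indicator_def simp flip: ennreal_mult')
    qed (simp add: powerlaw_density_def)
  qed
  also have "\<dots> = ennreal (K * (g powr (e - \<tau> + 1) / (e - \<tau> + 1)))"
    using assms K
    by (subst nn_integral_cmult, simp, subst nn_integral_powr_from_0) (auto simp: algebra_simps simp flip: ennreal_mult')
  also have "K * (g powr (e - \<tau> + 1) / (e - \<tau> + 1)) = (g powr (- e) * g powr (e - \<tau> + 1)) * ((\<tau> - 1) / (e + 1 - \<tau>))"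
    by (simp add: K_def algebra_simps)
  also have "g powr (- e) * g powr (e - \<tau> + 1) = g powr (1 - \<tau>)"
    by (simp flip: powr_add add: algebra_simps)
  finally show ?thesis .
qed

text \<open>Mirror image of the bound below the threshold: here the danger is at infinity, and
  \<open>e\<close> has to lie on the other side of \<open>\<tau> - 1\<close>.\<close>

lemma nn_integral_powerlaw_above:
  fixes g :: real
  assumes "1 < \<tau>" "e < \<tau> - 1" "0 < g"
  shows "(\<integral>\<^sup>+h. ennreal (powerlaw_density \<tau> h * (h / g) powr e * indicator {g..} h) \<partial>lborel)
           \<le> ennreal (g powr (1 - \<tau>) * ((\<tau> - 1) / (\<tau> - 1 - e)))"
proof -
  define K where "K = (\<tau> - 1) * g powr (- e)"
  have K: "K \<ge> 0" using assms by (simp add: K_def)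
  have "(\<integral>\<^sup>+h. ennreal (powerlaw_density \<tau> h * (h / g) powr e * indicator {g..} h) \<partial>lborel)
      \<le> (\<integral>\<^sup>+h. ennreal K * ennreal (indicator {g..} h * h powr (e - \<tau>)) \<partial>lborel)"
  proof (rule nn_integral_mono)
    fix h :: real
    show "ennreal (powerlaw_density \<tau> h * (h / g) powr e * indicator {g..} h)
        \<le> ennreal K * ennreal (indicator {g..} h * h powr (e - \<tau>))"
    proof (cases "1 \<le> h")
      case True
      then show ?thesis
        using K scaled_powerlaw_eq[OF assms(3) True, of \<tau> e]
        by (auto simp: K_def indicator_def simp flip: ennreal_mult')
    qed (simp add: powerlaw_density_def)
  qed
  also have "\<dots> = ennreal (K * (g powr (e - \<tau> + 1) / (\<tau> - e - 1)))"
    using assms K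
    by (subst nn_integral_cmult, simp, subst nn_integral_powr_to_inf) (auto simp: algebra_simps simp flip: ennreal_mult')
  also have "K * (g powr (e - \<tau> + 1) / (\<tau> - e - 1)) = (g powr (- e) * g powr (e - \<tau> + 1)) * ((\<tau> - 1) / (\<tau> - 1 - e))"
    by (simp add: K_def algebra_simps)
  also have "g powr (- e) * g powr (e - \<tau> + 1) = g powr (1 - \<tau>)"
    by (simp flip: powr_add add: algebra_simps)
  finally show ?thesis .
qed

section \<open>From a product over pairs to a product of powers of single weights\<close>

text \<open>\<open>vertex_pairs\<close> lists each pair once, in increasing order. Together with the
  swapped copies this fills the ordered pairs off the diagonal, so a product over edges can be
  regrouped by vertex.\<close>

lemma prod_vertex_pairs_symmetric:
  fixes f :: "nat \<Rightarrow> nat \<Rightarrow> 'a :: comm_monoid_mult"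
  assumes "finite S"
  shows "(\<Prod>(i, j)\<in>vertex_pairs S. f i j * f j i) = (\<Prod>i\<in>S. \<Prod>j\<in>S - {i}. f i j)"
proof -
  let ?W = "prod.swap ` vertex_pairs S"
  have "(\<Prod>(i, j)\<in>vertex_pairs S. f i j * f j i)
      = (\<Prod>(i, j)\<in>vertex_pairs S. f i j) * (\<Prod>(i, j)\<in>vertex_pairs S. f j i)"
    by (simp add: case_prod_unfold prod.distrib)
  also have "(\<Prod>(i, j)\<in>vertex_pairs S. f j i) = (\<Prod>(i, j)\<in>?W. f i j)"
    by (subst prod.reindex) (auto simp: case_prod_unfold)
  also have "(\<Prod>(i, j)\<in>vertex_pairs S. f i j) * (\<Prod>(i, j)\<in>?W. f i j)
      = (\<Prod>(i, j)\<in>vertex_pairs S \<union> ?W. f i j)"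
    using assms by (intro prod.union_disjoint[symmetric] finite_imageI finite_vertex_pairs) (auto simp: vertex_pairs_def)
  also have "vertex_pairs S \<union> ?W = Sigma S (\<lambda>i. S - {i})"
    by (auto simp: vertex_pairs_def image_iff)
  also have "(\<Prod>(i, j)\<in>Sigma S (\<lambda>i. S - {i}). f i j) = (\<Prod>i\<in>S. \<Prod>j\<in>S - {i}. f i j)"
    using assms by (subst prod.Sigma) auto
  finally show ?thesis .
qed

text \<open>Interpolates between the trivial bounds 1 (\<open>c = 0\<close>) and \<open>y\<close>
  (\<open>c = 1\<close>); this makes fractional borrowing possible.\<close>

lemma min_1_le_powr:
  fixes y c :: real
  assumes "0 < y" "0 \<le> c" "c \<le> 1"
  shows "min 1 y \<le> y powr c"
proof (cases "y \<le> 1")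
  case True
  then have "y powr 1 \<le> y powr c" using assms by (intro powr_mono') auto
  then show ?thesis using assms True by simp
next
  case False
  then show ?thesis using assms by (simp add: ge_one_powr_ge_zero)
qed

text \<open>View \<open>c\<close> as symmetric edge weights in the unit interval. Each edge passes
  its weight to both endpoints, so the exponent at a vertex is its weighted degree.\<close>

lemma prod_min_le_prod_powr:
  fixes x :: "nat \<Rightarrow> real" and c :: "nat \<Rightarrow> nat \<Rightarrow> real"
  assumes "finite S" and x: "\<And>i. i \<in> S \<Longrightarrow> 0 < x i"
    and c: "\<And>i j. 0 \<le> c i j" "\<And>i j. c i j \<le> 1" "\<And>i j. c i j = c j i"
  shows "(\<Prod>(i, j)\<in>vertex_pairs S. min 1 (x i * x j)) \<le> (\<Prod>i\<in>S. x i powr (\<Sum>j\<in>S - {i}. c i j))"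
proof -
  have "(\<Prod>(i, j)\<in>vertex_pairs S. min 1 (x i * x j)) \<le> (\<Prod>(i, j)\<in>vertex_pairs S. (x i * x j) powr c i j)"
    using x c by (intro prod_mono) (auto simp: vertex_pairs_def less_imp_le intro!: min_1_le_powr)
  also have "\<dots> = (\<Prod>(i, j)\<in>vertex_pairs S. x i powr c i j * x j powr c j i)"
    using x c(3) by (intro prod.cong) (auto simp: vertex_pairs_def powr_mult less_imp_le)
  also have "\<dots> = (\<Prod>i\<in>S. \<Prod>j\<in>S - {i}. x i powr c i j)"
    by (rule prod_vertex_pairs_symmetric) fact
  also have "\<dots> = (\<Prod>i\<in>S. x i powr (\<Sum>j\<in>S - {i}. c i j))"
    using x by (intro prod.cong refl powr_sum[symmetric]) (metis less_irrefl)
  finally show ?thesis .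
qed

text \<open>\<open>B\<close> holds the helper indices: they raise the exponent on \<open>A\<close>
  by \<open>s * card B\<close>, at the price of an exponent \<open>s * card A\<close> on
  \<open>B\<close> itself.\<close>

lemma prod_min_le:
  fixes x :: "nat \<Rightarrow> real"
  assumes S: "finite S" "A \<subseteq> S" "B \<subseteq> S" "A \<inter> B = {}" and x: "\<And>i. i \<in> S \<Longrightarrow> 0 < x i"
    and s: "0 \<le> s" "s \<le> 1"
  shows "(\<Prod>(i, j)\<in>vertex_pairs S. min 1 (x i * x j)) \<le>
     (\<Prod>i\<in>S. x i powr (if i \<in> A then real (card A) - 1 + s * real (card B)
                     else if i \<in> B then s * real (card A) else 0))"
proof -
  \<comment> \<open>\<open>min 1 y \<le> y powr c\<close> with \<open>c = 1\<close> inside \<open>A\<close>, \<open>c = s\<close> between \<open>A\<close> and \<open>B\<close>, and \<open>c = 0\<close> otherwise\<close>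
  define c where "c i j = (if i \<in> A \<and> j \<in> A then 1
      else if i \<in> A \<and> j \<in> B \<or> i \<in> B \<and> j \<in> A then s else 0)" for i j
  have fin: "finite A" "finite B" using S by (blast intro: finite_subset)+
  have sum: "(\<Sum>j\<in>S - {i}. c i j) = (if i \<in> A then real (card A) - 1 + s * real (card B)
                     else if i \<in> B then s * real (card A) else 0)" if "i \<in> S" for i
  proof -
    consider "i \<in> A" | "i \<in> B" "i \<notin> A" | "i \<notin> A" "i \<notin> B" by blast
    then show ?thesis
    proof cases
      case 1
      have "(\<Sum>j\<in>S - {i}. c i j) = (\<Sum>j\<in>(A - {i}) \<union> B. c i j)"
        using 1 S by (intro sum.mono_neutral_right) (auto simp: c_def)
      also have "\<dots> = (\<Sum>j\<in>A - {i}. c i j) + (\<Sum>j\<in>B. c i j)"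
        using S fin by (intro sum.union_disjoint) auto
      also have "(\<Sum>j\<in>A - {i}. c i j) = real (card A) - 1"
        using 1 fin card_gt_0_iff[of A] by (auto simp: c_def of_nat_diff Suc_le_eq)
      also have "(\<Sum>j\<in>B. c i j) = (\<Sum>j\<in>B. s)"
        using 1 S by (intro sum.cong) (auto simp: c_def)
      finally show ?thesis using 1 by (simp add: mult.commute)
    next
      case 2
      have "(\<Sum>j\<in>S - {i}. c i j) = (\<Sum>j\<in>A. c i j)"
        using 2 S by (intro sum.mono_neutral_right) (auto simp: c_def)
      also have "\<dots> = (\<Sum>j\<in>A. s)"
        using 2 S by (intro sum.cong) (auto simp: c_def)
      finally show ?thesis using 2 by (simp add: mult.commute)
    next
      case 3
      then show ?thesis by (simp add: c_def)
    qed
  qed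
  have "(\<Prod>(i, j)\<in>vertex_pairs S. min 1 (x i * x j)) \<le> (\<Prod>i\<in>S. x i powr (\<Sum>j\<in>S - {i}. c i j))"
    using S x s by (intro prod_min_le_prod_powr) (auto simp: c_def)
  then show ?thesis using sum by simp
qed

section \<open>The exponential series and a Stirling-type bound for
  \<open>fact (2 * a)\<close>\<close>

lemma even_partial_sum_le_exp:
  fixes y :: real
  assumes "0 \<le> y"
  shows "(\<Sum>a\<le>k. y ^ (2 * a) / fact (2 * a)) \<le> exp y"
proof -
  have "(\<Sum>a\<le>k. y ^ (2 * a) / fact (2 * a)) = (\<Sum>m\<in>(\<lambda>a. 2 * a) ` {..k}. y ^ m / fact m)"
    by (subst sum.reindex) (auto simp: inj_on_def)
  also have "\<dots> \<le> (\<Sum>m. y ^ m / fact m)"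
    using assms summable_exp_generic[of y]
    by (intro sum_le_suminf) (auto simp: scaleR_conv_of_real divide_inverse mult.commute)
  also have "\<dots> = exp y"
    by (simp add: exp_def scaleR_conv_of_real divide_inverse mult.commute)
  finally show ?thesis .
qed

text \<open>The logarithm of the induction step for \<open>fact_double_le\<close>, with the common
  factor 4 (a + 1) cancelled.\<close>

lemma ln_central_factorial_step:
  fixes a :: real
  assumes "1 \<le> a"
  shows "1 + a * ln a + ln (a + 1/2) \<le> (1 / a - 1 / (a + 1)) + (a + 1) * ln (a + 1)"
proof -
  \<comment> \<open>By convexity of 1/t, a difference of logarithms is at least the interval length
    divided by the midpoint.\<close>
  have 1: "a * (2 / (2 * a + 1)) \<le> a * (ln (a + 1) - ln a)"
    using ln_inverse_approx_ge[of a "a + 1"] assms by (intro mult_left_mono) (auto simp: algebra_simps)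
  have 2: "1 / (2 * a + 3/2) \<le> ln (a + 1) - ln (a + 1/2)"
    using ln_inverse_approx_ge[of "a + 1/2" "a + 1"] assms by (simp add: algebra_simps)
  \<comment> \<open>The midpoint bounds add up to 1 minus
    \<open>1 / ((2 * a + 1) * (4 * a + 3))\<close>; the telescoping difference
    \<open>1 / (a * (a + 1))\<close> pays for this deficit.\<close>
  have "0 \<le> a * (2 / (2 * a + 1)) + 1 / (2 * a + 3/2) + (1 / a - 1 / (a + 1)) - 1"
  proof -
    have "a * (2 / (2 * a + 1)) = 1 - 1 / (2 * a + 1)"
      using assms by (simp add: field_simps)
    moreover have "1 / (2 * a + 1) - 1 / (2 * a + 3/2) = 1 / ((2 * a + 1) * (4 * a + 3))"
      using assms by (simp add: divide_simps)
    moreover have "1 / a - 1 / (a + 1) = 1 / (a * (a + 1))"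
      using assms by (simp add: field_simps)
    moreover have "1 / ((2 * a + 1) * (4 * a + 3)) \<le> 1 / (a * (a + 1))"
      using assms by (intro divide_left_mono mult_mono) auto
    ultimately show ?thesis by linarith
  qed
  with 1 2 show ?thesis by (simp add: algebra_simps)
qed

text \<open>The correction \<open>- 1 / a\<close> in the exponent is what makes the induction go through.\<close>

lemma fact_double_le:
  assumes "1 \<le> a"
  shows "fact (2 * a) * exp (real a) \<le> exp (2 - 1 / real a) * 4 ^ a * fact a * real a ^ a"
  using assms
proof (induction a rule: nat_induct_at_least)
  case base
  show ?case by (simp add: fact_numeral)
next
  case (Suc a)
  define r where "r = real a"
  have r: "1 \<le> r" using Suc.hyps by (simp add: r_def)
  have "exp 1 * r ^ a * (r + 1/2) = exp (1 + r * ln r + ln (r + 1/2))"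
    using r by (simp add: exp_add r_def exp_of_nat_mult)
  also have "\<dots> \<le> exp ((1 / r - 1 / (r + 1)) + (r + 1) * ln (r + 1))"
    using ln_central_factorial_step[OF r] by simp
  also have "\<dots> = exp (1 / r - 1 / (r + 1)) * (r + 1) ^ Suc a"
    using r exp_of_nat_mult[of "Suc a" "ln (r + 1)"] by (simp add: exp_add r_def add.commute)
  finally have step: "exp 1 * r ^ a * (r + 1/2) \<le> exp (1 / r - 1 / (r + 1)) * (r + 1) ^ Suc a" .
  have "fact (2 * Suc a) * exp (real (Suc a)) = 4 * (r + 1) * (r + 1/2) * exp 1 * (fact (2 * a) * exp r)"
    by (simp add: r_def exp_add algebra_simps)
  also have "\<dots> \<le> 4 * (r + 1) * (r + 1/2) * exp 1 * (exp (2 - 1 / r) * 4 ^ a * fact a * r ^ a)"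
    using Suc.IH r by (intro mult_left_mono) (auto simp: r_def)
  also have "\<dots> = exp (2 - 1 / r) * 4 ^ Suc a * fact (Suc a) * (exp 1 * r ^ a * (r + 1/2))"
    by (simp add: r_def algebra_simps)
  also have "\<dots> \<le> exp (2 - 1 / r) * 4 ^ Suc a * fact (Suc a) * (exp (1 / r - 1 / (r + 1)) * (r + 1) ^ Suc a)"
    using step by (intro mult_left_mono) auto
  also have "\<dots> = (exp (2 - 1 / r) * exp (1 / r - 1 / (r + 1))) * 4 ^ Suc a * fact (Suc a) * (r + 1) ^ Suc a"
    by (simp only: mult_ac)
  also have "exp (2 - 1 / r) * exp (1 / r - 1 / (r + 1)) = exp (2 - 1 / real (Suc a))"
    by (simp add: r_def add.commute flip: exp_add)
  finally show ?case by (simp add: r_def add.commute)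
qed

section \<open>Exponents and constants for each region\<close>

text \<open>
  Up to the factor \<open>\<gamma>\<^sub>n powr (k * (1 - \<tau>))\<close>, a bound for the integral over the region where exactly
  the weights in a given set of \<open>a\<close> indices are below \<open>\<gamma>\<^sub>n\<close>.
\<close>

definition clique_region_const :: "real \<Rightarrow> nat \<Rightarrow> real" where
  "clique_region_const \<tau> a =
     (if a = 0 then 1
      else if a = 1 then (\<tau> - 1) / (3 - \<tau>) * ((\<tau> - 1) / (\<tau> - 2))\<^sup>2
      else if a = 2 then (4 * (\<tau> - 1) / (3 - \<tau>))\<^sup>2 * (2 * (\<tau> - 1) / (3 - \<tau>))
      else ((\<tau> - 1) / (real a - \<tau>)) ^ a)"

lemma clique_region_const_nonneg: "2 < \<tau> \<Longrightarrow> \<tau> < 3 \<Longrightarrow> 0 \<le> clique_region_const \<tau> a"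
  by (auto simp: clique_region_const_def)

lemma prod_two_values:
  assumes "finite S" "A \<subseteq> S" "B \<subseteq> S" "A \<inter> B = {}"
  shows "(\<Prod>i\<in>S. if i \<in> A then p else if i \<in> B then q else 1) = p ^ card A * (q :: real) ^ card B"
proof -
  have "(\<Prod>i\<in>S. if i \<in> A then p else if i \<in> B then q else 1) =
      (\<Prod>i\<in>S. (if i \<in> A then p else 1) * (if i \<in> B then q else 1))"
    using assms by (intro prod.cong) auto
  also have "\<dots> = p ^ card A * q ^ card B"
    using assms by (simp add: prod.distrib prod.If_cases Int_absorb1 Collect_mem_eq)
  finally show ?thesis .
qed

text \<open>Convergence at 0 needs exponents above \<open>\<tau> - 1\<close> on \<open>A\<close>,
  convergence at infinity needs them below off \<open>A\<close>. The pairs inside \<open>A\<close>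
  alone give \<open>card A - 1\<close>, which suffices from \<open>card A = 3\<close> on; smaller
  nonempty \<open>A\<close> take helpers from \<open>S - A\<close>, available since
  \<open>3 \<le> card S\<close>.\<close>

lemma clique_exponents:
  fixes \<tau> :: real
  assumes \<tau>: "2 < \<tau>" "\<tau> < 3" and "finite S" "3 \<le> card S" "A \<subseteq> S"
  obtains e :: "nat \<Rightarrow> real" where
    "\<And>x. (\<And>i. i \<in> S \<Longrightarrow> 0 < x i) \<Longrightarrow>
       (\<Prod>(i, j)\<in>vertex_pairs S. min 1 (x i * x j)) \<le> (\<Prod>i\<in>S. x i powr e i)"
    "\<And>i. i \<in> A \<Longrightarrow> \<tau> - 1 < e i" "\<And>i. i \<notin> A \<Longrightarrow> e i < \<tau> - 1"
    "(\<Prod>i\<in>S. (\<tau> - 1) / (if i \<in> A then e i + 1 - \<tau> else \<tau> - 1 - e i)) = clique_region_const \<tau> (card A)"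
proof -
  have "finite A" using assms by (blast intro: finite_subset)
  then have cd: "card (S - A) = card S - card A" using assms by (intro card_Diff_subset) auto
  obtain s B where B: "B \<subseteq> S - A" and s: "0 \<le> s" "s \<le> 1"
    \<comment> \<open>for \<open>card A = 2\<close>, \<open>s\<close> is the midpoint of the admissible interval from \<open>\<tau> - 2\<close> to \<open>(\<tau> - 1) / 2\<close>\<close>
    and cases: "card A = 1 \<and> card B = 2 \<and> s = 1 \<or> card A = 2 \<and> card B = 1 \<and> s = (3 * \<tau> - 5) / 4 \<or>
      (A = {} \<or> 3 \<le> card A) \<and> B = {} \<and> s = 0"
  proof -
    consider "card A = 1" | "card A = 2" | "A = {} \<or> 3 \<le> card A"
      using card_0_eq[OF \<open>finite A\<close>] by linarith
    then show thesis
    proof cases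
      case 1
      then have "2 \<le> card (S - A)" using cd assms by simp
      then obtain B where "B \<subseteq> S - A" "card B = 2"
        by (rule obtain_subset_with_card_n) blast
      then show ?thesis using 1 that[of B 1] by simp
    next
      case 2
      then have "1 \<le> card (S - A)" using cd assms by simp
      then obtain B where "B \<subseteq> S - A" "card B = 1"
        by (rule obtain_subset_with_card_n) blast
      then show ?thesis using 2 \<tau> that[of B "(3 * \<tau> - 5) / 4"] by simp
    next
      case 3
      then show ?thesis using that[of "{}" 0] by auto
    qed
  qed
  define eA eB where "eA = real (card A) - 1 + s * real (card B)" and "eB = s * real (card A)"
  define e where "e i = (if i \<in> A then eA else if i \<in> B then eB else 0)" for i
  \<comment> \<open>For \<open>card A = 1\<close> the exponents are 2 and 1, on either side of
    \<open>\<tau> - 1\<close>. For \<open>card A = 2\<close> they are \<open>1 + s\<close> and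
    \<open>2 * s\<close>, and both inequalities reduce to \<open>\<tau> < 3\<close>.\<close>
  have eA: "A \<noteq> {} \<Longrightarrow> \<tau> - 1 < eA" and eB: "B \<noteq> {} \<Longrightarrow> eB < \<tau> - 1"
    using cases \<tau> by (auto simp: eA_def eB_def field_simps)
  show thesis
  proof
    show "(\<Prod>(i, j)\<in>vertex_pairs S. min 1 (x i * x j)) \<le> (\<Prod>i\<in>S. x i powr e i)"
      if "\<And>i. i \<in> S \<Longrightarrow> 0 < x i" for x
      unfolding e_def eA_def eB_def using assms B s that by (intro prod_min_le) auto
    show "\<tau> - 1 < e i" if "i \<in> A" for i using that eA by (auto simp: e_def)
    show "e i < \<tau> - 1" if "i \<notin> A" for i using that eB \<tau> by (auto simp: e_def)
    have "(\<Prod>i\<in>S. (\<tau> - 1) / (if i \<in> A then e i + 1 - \<tau> else \<tau> - 1 - e i)) =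
        (\<Prod>i\<in>S. if i \<in> A then (\<tau> - 1) / (eA + 1 - \<tau>) else if i \<in> B then (\<tau> - 1) / (\<tau> - 1 - eB) else 1)"
      using \<tau> by (intro prod.cong) (auto simp: e_def)
    also have "\<dots> = ((\<tau> - 1) / (eA + 1 - \<tau>)) ^ card A * ((\<tau> - 1) / (\<tau> - 1 - eB)) ^ card B"
      using assms B by (intro prod_two_values) auto
    also have "\<dots> = clique_region_const \<tau> (card A)"
    proof -
      consider "card A = 1" "card B = 2" "s = 1" | "card A = 2" "card B = 1" "s = (3 * \<tau> - 5) / 4"
        | "A = {}" "B = {}" | "3 \<le> card A" "B = {}" "s = 0" using cases by blast
      then show ?thesis
      proof cases
        case 2
        then have eqs: "eA + 1 - \<tau> = (3 - \<tau>) / 4" "\<tau> - 1 - eB = (3 - \<tau>) / 2"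
          by (simp_all add: eA_def eB_def field_simps)
        show ?thesis unfolding eqs using 2 by (simp add: clique_region_const_def mult_ac)
      qed (auto simp: clique_region_const_def eA_def eB_def)
    qed
    finally show "(\<Prod>i\<in>S. (\<tau> - 1) / (if i \<in> A then e i + 1 - \<tau> else \<tau> - 1 - e i)) = clique_region_const \<tau> (card A)" .
  qed
qed

section \<open>Integrating region by region\<close>

lemma sum_Pow_card:
  fixes f :: "nat \<Rightarrow> real"
  assumes "finite S"
  shows "(\<Sum>A\<in>Pow S. f (card A)) = (\<Sum>a\<le>card S. real (card S choose a) * f a)"
proof -
  have "(\<Sum>A\<in>Pow S. f (card A)) = (\<Sum>a\<le>card S. \<Sum>A\<in>{A \<in> Pow S. card A = a}. f (card A))"
    using assms by (intro sum.group[symmetric]) (auto intro: card_mono)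
  also have "\<dots> = (\<Sum>a\<le>card S. real (card S choose a) * f a)"
    using assms by (intro sum.cong refl) (simp add: n_subsets)
  finally show ?thesis .
qed

text \<open>On each region the majorant is a product of one-variable functions, so its integral
  factorizes. The bound depends only on \<open>card A\<close>, and grouping the regions by size
  produces the binomial coefficients.\<close>

lemma clique_integral_le:
  fixes \<tau> g :: real
  assumes \<tau>: "2 < \<tau>" "\<tau> < 3" and "0 < g" "3 \<le> k"
  shows "(\<integral>h. (\<Prod>i<k. powerlaw_density \<tau> (h i)) *
                (\<Prod>(i, j)\<in>vertex_pairs {..<k}. min 1 (h i * h j / g\<^sup>2)) \<partial>(\<Pi>\<^sub>M i\<in>{..<k}. lborel))
         \<le> g powr (real k * (1 - \<tau>)) * (\<Sum>a\<le>k. real (k choose a) * clique_region_const \<tau> a)"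
proof -
  let ?M = "\<Pi>\<^sub>M i\<in>{..<k}. lborel :: real measure"
  let ?P = "\<lambda>x. \<Prod>(i, j)\<in>vertex_pairs {..<k}. min 1 (x i * x j :: real)"
  interpret L: product_sigma_finite "\<lambda>_::nat. lborel :: real measure"
    by unfold_locales
  \<comment> \<open>Bundles the conclusions of \<open>clique_exponents\<close> so that one choice
    function \<open>E\<close> supplies exponents for all \<open>A\<close>.\<close>
  define Q where "Q A e \<longleftrightarrow> (\<forall>x. (\<forall>i\<in>{..<k}. 0 < x i) \<longrightarrow> ?P x \<le> (\<Prod>i<k. x i powr e i)) \<and>
      (\<forall>i\<in>A. \<tau> - 1 < e i) \<and> (\<forall>i. i \<notin> A \<longrightarrow> e i < \<tau> - 1) \<and>
      (\<Prod>i<k. (\<tau> - 1) / (if i \<in> A then e i + 1 - \<tau> else \<tau> - 1 - e i)) = clique_region_const \<tau> (card A)"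
    for A and e :: "nat \<Rightarrow> real"
  have "\<exists>e. Q A e" if A: "A \<in> Pow {..<k}" for A
  proof (rule clique_exponents[OF \<tau>, of "{..<k}" A])
    fix e :: "nat \<Rightarrow> real"
    assume "\<And>x. (\<And>i. i \<in> {..<k} \<Longrightarrow> 0 < x i) \<Longrightarrow> ?P x \<le> (\<Prod>i<k. x i powr e i)"
      and "\<And>i. i \<in> A \<Longrightarrow> \<tau> - 1 < e i" "\<And>i. i \<notin> A \<Longrightarrow> e i < \<tau> - 1"
      and "(\<Prod>i<k. (\<tau> - 1) / (if i \<in> A then e i + 1 - \<tau> else \<tau> - 1 - e i)) = clique_region_const \<tau> (card A)"
    then show ?thesis unfolding Q_def by blast
  qed (use A \<open>3 \<le> k\<close> in auto)
  then obtain E where E: "Q A (E A)" if "A \<in> Pow {..<k}" for A by metis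
  note E_le = E[unfolded Q_def, THEN conjunct1, rule_format]
    and E_in = E[unfolded Q_def, THEN conjunct2, THEN conjunct1, rule_format]
    and E_out = E[unfolded Q_def, THEN conjunct2, THEN conjunct2, THEN conjunct1, rule_format]
    and E_const = E[unfolded Q_def, THEN conjunct2, THEN conjunct2, THEN conjunct2]
  define G where "G A i h = powerlaw_density \<tau> h * (h / g) powr E A i *
      indicator (if i \<in> A then {..<g} else {g..}) h" for A :: "nat set" and i :: nat and h :: real
  have G_nonneg: "0 \<le> G A i h" for A i h
    using \<tau> by (simp add: G_def powerlaw_density_nonneg)
  have [measurable]: "G A i \<in> borel_measurable borel" for A i
    unfolding G_def by measurable
  have G_int: "(\<integral>\<^sup>+h. (\<Prod>i<k. ennreal (G A i (h i))) \<partial>?M)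
      \<le> ennreal (g powr (real k * (1 - \<tau>)) * clique_region_const \<tau> (card A))" if A: "A \<in> Pow {..<k}" for A
  proof -
    let ?K = "\<lambda>i. (\<tau> - 1) / (if i \<in> A then E A i + 1 - \<tau> else \<tau> - 1 - E A i)"
    have K: "0 \<le> ?K i" for i using \<tau> E_in[OF A, of i] E_out[OF A, of i] by auto
    have "(\<integral>\<^sup>+h. (\<Prod>i<k. ennreal (G A i (h i))) \<partial>?M) = (\<Prod>i<k. \<integral>\<^sup>+h. ennreal (G A i h) \<partial>lborel)"
      by (intro L.product_nn_integral_prod) auto
    also have "\<dots> \<le> (\<Prod>i<k. ennreal (g powr (1 - \<tau>) * ?K i))"
    proof (rule prod_mono_ennreal)
      fix i
      show "(\<integral>\<^sup>+h. ennreal (G A i h) \<partial>lborel) \<le> ennreal (g powr (1 - \<tau>) * ?K i)"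
        using \<tau> \<open>0 < g\<close> E_in[OF A, of i] E_out[OF A, of i]
          nn_integral_powerlaw_below[of \<tau> "E A i" g] nn_integral_powerlaw_above[of \<tau> "E A i" g]
        by (simp add: G_def)
    qed
    also have "\<dots> = ennreal (\<Prod>i<k. g powr (1 - \<tau>) * ?K i)"
      using K by (intro prod_ennreal mult_nonneg_nonneg) simp_all
    also have "(\<Prod>i<k. g powr (1 - \<tau>) * ?K i) = g powr (real k * (1 - \<tau>)) * clique_region_const \<tau> (card A)"
      unfolding prod.distrib E_const[OF A] using \<open>0 < g\<close> by (simp add: powr_powr mult.commute flip: powr_realpow)
    finally show ?thesis .
  qed
  have pointwise: "ennreal ((\<Prod>i<k. powerlaw_density \<tau> (h i)) *
        (\<Prod>(i, j)\<in>vertex_pairs {..<k}. min 1 (h i * h j / g\<^sup>2)))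
      \<le> (\<Sum>A\<in>Pow {..<k}. \<Prod>i<k. ennreal (G A i (h i)))" for h
  proof (cases "\<forall>i<k. 1 \<le> h i")
    case True
    \<comment> \<open>The region containing \<open>h\<close>: its summand alone dominates the
      integrand, and the other summands are nonnegative.\<close>
    define A where "A = {i. i < k \<and> h i < g}"
    have A: "A \<in> Pow {..<k}" by (auto simp: A_def)
    have "(\<Prod>(i, j)\<in>vertex_pairs {..<k}. min 1 (h i * h j / g\<^sup>2)) = ?P (\<lambda>i. h i / g)"
      by (simp add: power2_eq_square)
    also have "\<dots> \<le> (\<Prod>i<k. (h i / g) powr E A i)"
      using True \<open>0 < g\<close> by (intro E_le[OF A]) force
    finally have "(\<Prod>i<k. powerlaw_density \<tau> (h i)) *
        (\<Prod>(i, j)\<in>vertex_pairs {..<k}. min 1 (h i * h j / g\<^sup>2)) \<le>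
        (\<Prod>i<k. powerlaw_density \<tau> (h i)) * (\<Prod>i<k. (h i / g) powr E A i)"
      using \<tau> by (intro mult_left_mono prod_nonneg) (auto simp: powerlaw_density_nonneg)
    also have "\<dots> = (\<Prod>i<k. G A i (h i))"
      unfolding prod.distrib[symmetric] by (intro prod.cong refl) (auto simp: G_def A_def)
    finally have "ennreal ((\<Prod>i<k. powerlaw_density \<tau> (h i)) *
        (\<Prod>(i, j)\<in>vertex_pairs {..<k}. min 1 (h i * h j / g\<^sup>2))) \<le> (\<Prod>i<k. ennreal (G A i (h i)))"
      using G_nonneg by (simp add: prod_ennreal ennreal_leI)
    also have "\<dots> \<le> (\<Sum>A\<in>Pow {..<k}. \<Prod>i<k. ennreal (G A i (h i)))"
      by (rule member_le_sum[OF A]) auto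
    finally show ?thesis .
  next
    case False
    then have "(\<Prod>i<k. powerlaw_density \<tau> (h i)) = 0"
      by (auto simp: powerlaw_density_def)
    then show ?thesis by (simp only: mult_zero_left ennreal_0 zero_le)
  qed
  have "(\<integral>\<^sup>+h. ennreal ((\<Prod>i<k. powerlaw_density \<tau> (h i)) *
        (\<Prod>(i, j)\<in>vertex_pairs {..<k}. min 1 (h i * h j / g\<^sup>2))) \<partial>?M)
      \<le> (\<integral>\<^sup>+h. (\<Sum>A\<in>Pow {..<k}. \<Prod>i<k. ennreal (G A i (h i))) \<partial>?M)"
    by (intro nn_integral_mono pointwise)
  also have "\<dots> = (\<Sum>A\<in>Pow {..<k}. \<integral>\<^sup>+h. (\<Prod>i<k. ennreal (G A i (h i))) \<partial>?M)"
    by (intro nn_integral_sum) measurable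
  also have "\<dots> \<le> (\<Sum>A\<in>Pow {..<k}. ennreal (g powr (real k * (1 - \<tau>)) * clique_region_const \<tau> (card A)))"
    by (intro sum_mono G_int)
  also have "\<dots> = ennreal (\<Sum>A\<in>Pow {..<k}. g powr (real k * (1 - \<tau>)) * clique_region_const \<tau> (card A))"
    using \<tau> by (intro sum_ennreal) (simp add: clique_region_const_nonneg)
  also have "(\<Sum>A\<in>Pow {..<k}. g powr (real k * (1 - \<tau>)) * clique_region_const \<tau> (card A)) =
      g powr (real k * (1 - \<tau>)) * (\<Sum>a\<le>k. real (k choose a) * clique_region_const \<tau> a)"
    using sum_Pow_card[of "{..<k}" "clique_region_const \<tau>"] by (simp flip: sum_distrib_left)
  finally show ?thesis
    using \<tau> by (intro integral_real_bounded) (auto intro!: mult_nonneg_nonneg sum_nonneg simp: clique_region_const_nonneg)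
qed

section \<open>Comparing the sum of the region constants with the exponential series\<close>

text \<open>For \<open>3 \<le> a\<close> the constant splits into
  \<open>((\<tau> - 1) / a) ^ a\<close> and \<open>(a / (a - \<tau>)) ^ a\<close>. The second factor
  is bounded, and \<open>fact_double_le\<close> rewrites the power of \<open>a\<close> in the first
  through factorials.\<close>

lemma clique_region_const_le_central_term:
  fixes \<tau> :: real
  assumes \<tau>: "2 < \<tau>" "\<tau> < 3"
  obtains D where "0 \<le> D"
    "\<And>a. clique_region_const \<tau> a \<le> D * (fact a * (4 * (\<tau> - 1) / exp 1) ^ a / fact (2 * a))"
proof -
  define w where "w a = fact a * (4 * (\<tau> - 1) / exp 1) ^ a / fact (2 * a)" for a
  have w: "0 < w a" for a using \<tau> by (simp add: w_def)
  define D0 where "D0 = exp 2 * exp (3 * \<tau> / (3 - \<tau>))"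
  have big: "clique_region_const \<tau> a \<le> D0 * w a" if a: "3 \<le> a" for a
  proof -
    define r where "r = real a"
    have r: "3 \<le> r" using a by (simp add: r_def)
    have "r / (r - \<tau>) = 1 + \<tau> / (r - \<tau>)" using r \<tau> by (simp add: field_simps)
    also have "\<dots> \<le> exp (\<tau> / (r - \<tau>))" by (rule exp_ge_add_one_self)
    finally have "(r / (r - \<tau>)) ^ a \<le> exp (\<tau> / (r - \<tau>)) ^ a"
      using r \<tau> by (intro power_mono) auto
    also have "\<dots> = exp (r * \<tau> / (r - \<tau>))"
      by (simp add: r_def exp_of_nat_mult[symmetric])
    \<comment> \<open>The exponent decreases in \<open>r\<close> beyond \<open>\<tau>\<close>, so
      its value at \<open>r = 3\<close> is the largest.\<close>
    also have "\<dots> \<le> exp (3 * \<tau> / (3 - \<tau>))"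
      using r \<tau> by (simp add: frac_le_eq field_simps)
    finally have 1: "(r / (r - \<tau>)) ^ a \<le> exp (3 * \<tau> / (3 - \<tau>))" .
    have "fact (2 * a) * exp r \<le> exp (2 - 1 / r) * 4 ^ a * fact a * r ^ a"
      using fact_double_le[of a] a by (simp add: r_def)
    also have "\<dots> \<le> exp 2 * 4 ^ a * fact a * r ^ a"
      using r by (intro mult_right_mono) auto
    finally have 2: "fact (2 * a) * exp r \<le> exp 2 * 4 ^ a * fact a * r ^ a" .
    have e: "exp r = exp 1 ^ a" by (simp add: r_def exp_of_nat_mult[symmetric])
    have "clique_region_const \<tau> a = (\<tau> - 1) ^ a / r ^ a * (r / (r - \<tau>)) ^ a"
      using a r by (simp add: clique_region_const_def r_def power_divide)
    also have "\<dots> \<le> (\<tau> - 1) ^ a / r ^ a * exp (3 * \<tau> / (3 - \<tau>))"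
      using \<tau> r by (intro mult_left_mono 1) auto
    also have "(\<tau> - 1) ^ a / r ^ a \<le> exp 2 * w a"
    proof -
      have "(\<tau> - 1) ^ a * (fact (2 * a) * exp r) \<le> (\<tau> - 1) ^ a * (exp 2 * 4 ^ a * fact a * r ^ a)"
        using \<tau> by (intro mult_left_mono 2) auto
      then show ?thesis
        using r unfolding w_def e power_divide power_mult_distrib by (simp add: divide_simps mult_ac)
    qed
    finally show ?thesis by (simp add: D0_def mult_ac)
  qed
  \<comment> \<open>The added ratios absorb the three exceptional sizes 0, 1 and 2.\<close>
  define D where "D = D0 + (\<Sum>a<3. clique_region_const \<tau> a / w a)"
  have nn: "0 \<le> clique_region_const \<tau> a / w a" for a using clique_region_const_nonneg[OF \<tau>] w[of a] by simp
  have "0 \<le> D0" by (simp add: D0_def)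
  have "clique_region_const \<tau> a \<le> D * w a" for a
  proof (cases "3 \<le> a")
    case True
    have "D0 * w a \<le> D * w a" using nn w[of a] by (intro mult_right_mono) (auto simp: D_def sum_nonneg)
    with big[OF True] show ?thesis by simp
  next
    case False
    then have "clique_region_const \<tau> a / w a \<le> (\<Sum>a<3. clique_region_const \<tau> a / w a)"
      using nn by (intro member_le_sum) auto
    then have "clique_region_const \<tau> a / w a \<le> D" using \<open>0 \<le> D0\<close> by (simp add: D_def)
    then show ?thesis using w[of a] by (simp add: field_simps)
  qed
  moreover have "0 \<le> D" using \<open>0 \<le> D0\<close> nn by (simp add: D_def sum_nonneg)
  ultimately show thesis using that unfolding w_def by blast
qed

text \<open>The factor \<open>fact a\<close> is absorbed by
  \<open>(k choose a) * fact a \<le> k ^ a\<close>. What remains is an even term of the series of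
  \<open>exp y\<close> with \<open>y\<^sup>2 = 4 * k * (\<tau> - 1) / e\<close>, where e is
  \<open>exp 1\<close>.\<close>

lemma binomial_region_sum_le:
  fixes \<tau> D :: real
  assumes "1 < \<tau>" "0 \<le> D"
    and K: "\<And>a. K a \<le> D * (fact a * (4 * (\<tau> - 1) / exp 1) ^ a / fact (2 * a))"
  shows "(\<Sum>a\<le>k. real (k choose a) * K a) \<le> D * exp (2 * sqrt (real k * (\<tau> - 1) / exp 1))"
proof -
  define y where "y = 2 * sqrt (real k * (\<tau> - 1) / exp 1)"
  have y: "y ^ (2 * a) = real k ^ a * (4 * (\<tau> - 1) / exp 1) ^ a" for a
  proof -
    have "y\<^sup>2 = real k * (4 * (\<tau> - 1) / exp 1)"
      using assms by (simp add: y_def power_mult_distrib real_sqrt_pow2)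
    then show ?thesis by (simp only: power_mult power_mult_distrib)
  qed
  have "real (k choose a) * K a \<le> D * (y ^ (2 * a) / fact (2 * a))" for a
  proof -
    have c: "real (k choose a) * fact a \<le> real k ^ a"
      using binomial_fact_pow[of k a] by (metis of_nat_fact of_nat_le_iff of_nat_mult of_nat_power)
    have "real (k choose a) * K a \<le> real (k choose a) * (D * (fact a * (4 * (\<tau> - 1) / exp 1) ^ a / fact (2 * a)))"
      by (intro mult_left_mono K) auto
    also have "\<dots> = (real (k choose a) * fact a) * (D * ((4 * (\<tau> - 1) / exp 1) ^ a / fact (2 * a)))"
      by simp
    also have "\<dots> \<le> real k ^ a * (D * ((4 * (\<tau> - 1) / exp 1) ^ a / fact (2 * a)))"
      using assms by (intro mult_right_mono c) auto
    also have "\<dots> = D * (y ^ (2 * a) / fact (2 * a))" by (simp add: y)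
    finally show ?thesis .
  qed
  then have "(\<Sum>a\<le>k. real (k choose a) * K a) \<le> D * (\<Sum>a\<le>k. y ^ (2 * a) / fact (2 * a))"
    unfolding sum_distrib_left by (intro sum_mono)
  also have "\<dots> \<le> D * exp y"
    using assms by (intro mult_left_mono even_partial_sum_le_exp) (auto simp: y_def)
  finally show ?thesis by (simp add: y_def)
qed

theorem theorem3p5:
  fixes \<tau> :: real
  assumes "2 < \<tau>" and "\<tau> < 3"
  shows "\<exists>C::real. \<forall>k::nat. 3 \<le> k \<longrightarrow>
           limsup (\<lambda>n. ereal (rank1_cliques \<tau> k n /
             (real (n choose k) * gam \<tau> n powr (real k * (1 - \<tau>))
                * exp (2 * sqrt (real k * (\<tau> - 1) / exp 1)))))
           \<le> ereal C"
proof -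
  obtain D where D: "0 \<le> D"
    "\<And>a. clique_region_const \<tau> a \<le> D * (fact a * (4 * (\<tau> - 1) / exp 1) ^ a / fact (2 * a))"
    using clique_region_const_le_central_term[OF assms] by blast
  \<comment> \<open>The bound holds for every \<open>n\<close>, so the limsup inherits it.\<close>
  have "rank1_cliques \<tau> k n / (real (n choose k) * gam \<tau> n powr (real k * (1 - \<tau>))
          * exp (2 * sqrt (real k * (\<tau> - 1) / exp 1))) \<le> D" if k: "3 \<le> k" for k n
  \<comment> \<open>If there are fewer than \<open>k\<close> vertices, the denominator vanishes and
    the quotient is 0 by convention.\<close>
  proof (cases "n choose k = 0")
    case True
    then show ?thesis using D(1) by (simp only: of_nat_0 mult_zero_left div_by_0)
  next
    case False
    with k have "0 < n" by (cases n) auto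
    then have g: "0 < gam \<tau> n" using assms by (simp add: gam_def mean_weight_def)
    let ?g = "gam \<tau> n powr (real k * (1 - \<tau>))" and ?e = "exp (2 * sqrt (real k * (\<tau> - 1) / exp 1))"
    have "rank1_cliques \<tau> k n \<le> real (n choose k) * (?g * (\<Sum>a\<le>k. real (k choose a) * clique_region_const \<tau> a))"
      unfolding rank1_cliques_eq[OF assms(1)]
      by (intro mult_left_mono clique_integral_le assms g k) simp
    also have "\<dots> \<le> real (n choose k) * (?g * (D * ?e))"
      using assms D by (intro mult_left_mono binomial_region_sum_le) auto
    finally show ?thesis
      using False g by (simp add: divide_le_eq mult_ac)
  qed
  then have "\<forall>k\<ge>3. limsup (\<lambda>n. ereal (rank1_cliques \<tau> k n /
             (real (n choose k) * gam \<tau> n powr (real k * (1 - \<tau>))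
                * exp (2 * sqrt (real k * (\<tau> - 1) / exp 1))))) \<le> ereal D"
    by (intro allI impI Limsup_bounded always_eventually) simp
  then show ?thesis by blast
qed

end
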